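(* For any independent random variables $X_1,\ldots,X_n$ with two-point distributions, $$\frac{E[\max(X_1,\ldots,X_n)]}{\max_\sigma V_\sigma}\le 1.25,$$ where the maximum is over all permutations $\sigma$ of $\{1,\ldots,n\}$.
   Context: A two-point distribution for $X_i$: $X_i=a_i$ with probability $1-p_i$ and $X_i=b_i$ with probability $p_i$, where $a_i\le b_i$. For a permutation $\sigma$, the player observes $X_{\sigma(1)},X_{\sigma(2)},\ldots$ in order and may stop after each observation receiving the observed value, receiving $0$ if she never stops. $V_\sigma$ is the maximum expected reward over stopping rules: $V_\sigma(n+1)=0$, $V_\sigma(j)=E[\max(X_{\sigma(j)},V_\sigma(j+1))]$, $V_\sigma:=V_\sigma(1)$. *)

theory Defs
  imports "HOL-Probability.Probability" "HOL-Combinatorics.Permutations"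
begin

text \<open>Value \<open>a\<close> has probability \<open>1 - p\<close> and \<open>b\<close> has probability \<open>p\<close>. The law is the image of a
  Bernoulli distribution, so that the degenerate case \<open>a = b\<close> (a point mass) is covered too.\<close>

definition two_point_distributed ::
    "'a measure \<Rightarrow> ('a \<Rightarrow> real) \<Rightarrow> real \<Rightarrow> real \<Rightarrow> real \<Rightarrow> bool" where
  "two_point_distributed M X a b p \<longleftrightarrow>
     a \<le> b \<and> 0 \<le> p \<and> p \<le> 1 \<and> X \<in> borel_measurable M \<and>
     distr M borel X = distr (measure_pmf (bernoulli_pmf p)) borel (\<lambda>c. if c then b else a)"

text \<open>Value of optimal stopping before the \<open>j\<close>-th observation when the variables
  \<open>X 1, \<dots>, X n\<close> are observed in the order \<open>\<sigma> 1, \<dots>, \<sigma> n\<close>.\<close>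

function stopping_value_from ::
    "'a measure \<Rightarrow> nat \<Rightarrow> (nat \<Rightarrow> 'a \<Rightarrow> real) \<Rightarrow> (nat \<Rightarrow> nat) \<Rightarrow> nat \<Rightarrow> real" where
  "stopping_value_from M n X \<sigma> j =
     (if j > n then 0
      else integral\<^sup>L M (\<lambda>\<omega>. max (X (\<sigma> j) \<omega>) (stopping_value_from M n X \<sigma> (Suc j))))"
  by pat_completeness auto
termination
  by (relation "Wellfounded.measure (\<lambda>(M, n, X, \<sigma>, j). Suc n - j)") auto

declare stopping_value_from.simps [simp del]

definition stopping_value ::
    "'a measure \<Rightarrow> nat \<Rightarrow> (nat \<Rightarrow> 'a \<Rightarrow> real) \<Rightarrow> (nat \<Rightarrow> nat) \<Rightarrow> real" where
  "stopping_value M n X \<sigma> = stopping_value_from M n X \<sigma> 1"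

end

theory Submission
  imports Defs
begin

text \<open>Negative observations are never accepted, so the values may be truncated at \<open>0\<close>. Let \<open>m\<close>
  maximise the low values \<open>a\<close>, put \<open>A = a m\<close>, let \<open>H\<close> be the variables with \<open>b > b m\<close> and \<open>L\<close>
  those with \<open>A \<le> b \<le> b m\<close>, both sorted by decreasing \<open>b\<close>. Accepting the first high value in the
  order \<open>H, m, L\<close>, with \<open>A\<close> as consolation prize, gives the expected maximum. A player can imitate
  this in three ways: observe \<open>H, m, L\<close> and forgo the consolation prize, observe \<open>H, L, m\<close>
  accepting every high value, or observe \<open>H, L, m\<close> without ever accepting a variable of \<open>L\<close>. By
  AM-GM the smallest of the three losses is at most a fifth of the expected maximum.\<close>

section \<open>Payoffs along a list: a fixed acceptance rule and optimal stopping\<close>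

text \<open>For probabilities \<open>p\<close>, this is the mean payoff of taking the first high
  value along \<open>xs\<close>, with \<open>v\<close> paid if there is none. The weights are
  arbitrary reals because random indicators are also substituted for them.\<close>

definition accept_value :: "(nat \<Rightarrow> real) \<Rightarrow> (nat \<Rightarrow> real) \<Rightarrow> nat list \<Rightarrow> real \<Rightarrow> real" where
  "accept_value b p xs v = foldr (\<lambda>i v. p i * b i + (1 - p i) * v) xs v"

definition reward ::
    "(nat \<Rightarrow> real) \<Rightarrow> (nat \<Rightarrow> real) \<Rightarrow> (nat \<Rightarrow> real) \<Rightarrow> nat list \<Rightarrow> real \<Rightarrow> real" where
  "reward a b p xs v = foldr (\<lambda>i v. p i * max (b i) v + (1 - p i) * max (a i) v) xs v"

lemma accept_value_simps [simp]:
  "accept_value b p [] v = v"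
  "accept_value b p (i # xs) v = p i * b i + (1 - p i) * accept_value b p xs v"
  "accept_value b p (xs @ ys) v = accept_value b p xs (accept_value b p ys v)"
  by (simp_all add: accept_value_def)

lemma reward_simps [simp]:
  "reward a b p [] v = v"
  "reward a b p (i # xs) v =
     p i * max (b i) (reward a b p xs v) + (1 - p i) * max (a i) (reward a b p xs v)"
  "reward a b p (xs @ ys) v = reward a b p xs (reward a b p ys v)"
  by (simp_all add: reward_def)

text \<open>The payoff \<open>v\<close> is received exactly when no entry is high, so its
  coefficient is the probability of that event.\<close>

lemma accept_value_affine:
  "accept_value b p xs v = accept_value b p xs 0 + (\<Prod>i\<leftarrow>xs. 1 - p i) * v"
  by (induction xs) (simp_all add: algebra_simps)

lemma convex_ge:
  fixes x y c q :: real
  assumes "0 \<le> q" "q \<le> 1" "c \<le> x" "c \<le> y"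
  shows "c \<le> q * x + (1 - q) * y"
proof -
  have "q * c + (1 - q) * c \<le> q * x + (1 - q) * y"
    using assms by (intro add_mono mult_left_mono) auto
  then show ?thesis by (simp add: algebra_simps)
qed

lemma convex_le:
  fixes x y c q :: real
  assumes "0 \<le> q" "q \<le> 1" "x \<le> c" "y \<le> c"
  shows "q * x + (1 - q) * y \<le> c"
  using convex_ge[of q "-c" "-x" "-y"] assms by simp

lemma accept_value_ge:
  assumes "\<And>i. i \<in> set xs \<Longrightarrow> 0 \<le> p i \<and> p i \<le> 1 \<and> c \<le> b i" "c \<le> v"
  shows "c \<le> accept_value b p xs v"
  using assms by (induction xs) (auto intro!: convex_ge)

lemma accept_value_le:
  assumes "\<And>i. i \<in> set xs \<Longrightarrow> 0 \<le> p i \<and> p i \<le> 1 \<and> b i \<le> c" "v \<le> c"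
  shows "accept_value b p xs v \<le> c"
  using assms by (induction xs) (auto intro!: convex_le)

text \<open>The player may decline everything in \<open>xs\<close>; this is what allows skipping
  \<open>L\<close> and placing useless variables in front.\<close>

lemma le_reward:
  assumes "\<And>i. i \<in> set xs \<Longrightarrow> 0 \<le> p i \<and> p i \<le> 1"
  shows "v \<le> reward a b p xs v"
  using assms by (induction xs) (auto intro!: convex_ge simp: le_max_iff_disj)

lemma reward_mono:
  assumes "\<And>i. i \<in> set xs \<Longrightarrow> 0 \<le> p i \<and> p i \<le> 1" "v \<le> w"
  shows "reward a b p xs v \<le> reward a b p xs w"
  using assms
  by (induction xs) (auto intro!: add_mono mult_left_mono max.mono)

lemma accept_value_le_reward:
  assumes "\<And>i. i \<in> set xs \<Longrightarrow> 0 \<le> p i \<and> p i \<le> 1"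
  shows "accept_value b p xs v \<le> reward a b p xs v"
  using assms
  by (induction xs) (auto intro!: add_mono mult_left_mono simp: le_max_iff_disj)

section \<open>The factor 5/4 for deterministic recursions\<close>

text \<open>This is the situation after \<open>H\<close> has shown no high value: \<open>l\<close>
  is the probability that \<open>L\<close> shows none, \<open>W\<close> the mean payoff from
  \<open>L\<close> alone, and \<open>R1\<close>, \<open>R2\<close>, \<open>R3\<close> are the three
  imitations. The target splits as \<open>A + y + z\<close>. The loss \<open>t\<close> is at most
  each of \<open>l * A\<close>, \<open>(1 - l) * y\<close> and \<open>z\<close>; the first two
  bounds give \<open>4 * t \<le> A + y\<close>, so \<open>5 * t\<close> is at most the
  target.\<close>

lemma loss_bound:
  fixes A b p l W R :: real
  assumes A: "0 \<le> A" "A \<le> b" and p: "0 \<le> p" "p \<le> 1" and l: "0 \<le> l" "l \<le> 1"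
    and W: "(1 - l) * A \<le> W" "W \<le> (1 - l) * b"
    and R1: "W + l * (p * b + (1 - p) * A) \<le> R"
    and R2: "p * b + (1 - p) * W \<le> R"
    and R3: "p * b + (1 - p) * A \<le> R"
  shows "p * b + (1 - p) * (W + l * A) \<le> 5 / 4 * R"
proof (rule ccontr)
  assume neg: "\<not> ?thesis"
  define t where "t = p * b + (1 - p) * (W + l * A) - R"
  define y where "y = p * (b - A)"
  define d where "d = W - (1 - l) * A"
  define z where "z = (1 - p) * d"
  have d0: "0 \<le> d" and y0: "0 \<le> y" using W A p by (auto simp: d_def y_def)
  have R0: "0 \<le> R" using R3 A p by (smt (verit) mult_nonneg_nonneg)
  have O: "p * b + (1 - p) * (W + l * A) = A + y + z"
    by (simp add: y_def d_def z_def algebra_simps)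
  have t0: "0 < t" using neg R0 unfolding t_def by linarith
  have t1: "t \<le> p * ((1 - l) * b - W)" using R1 by (simp add: t_def algebra_simps)
  have t2: "t \<le> (1 - p) * (l * A)" using R2 by (simp add: t_def algebra_simps)
  have t3: "t \<le> z" using R3 by (simp add: t_def d_def z_def algebra_simps)
  have lA: "t \<le> l * A"
    using t2 mult_right_mono[of "1 - p" 1 "l * A"] p l A by simp
  have "p * ((1 - l) * b - W) = (1 - l) * y - p * d"
    by (simp add: y_def d_def algebra_simps)
  then have ly: "t \<le> (1 - l) * y"
    using t1 mult_nonneg_nonneg[OF p(1) d0] by linarith
  \<comment> \<open>Multiplying the two bounds (\<open>t\<close> is positive by contradiction) lets
    AM-GM act twice: on \<open>l\<close> and \<open>1 - l\<close>, then on \<open>A\<close> and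
    \<open>y\<close>.\<close>
  have "t * t \<le> (l * A) * ((1 - l) * y)"
    using lA ly t0 by (intro mult_mono) auto
  also have "\<dots> = (l * (1 - l)) * (A * y)" by simp
  also have "\<dots> \<le> 1 / 4 * (A * y)"
  proof (rule mult_right_mono)
    have "0 \<le> (l - 1 / 2)\<^sup>2" by simp
    then show "l * (1 - l) \<le> 1 / 4" by (simp add: power2_eq_square algebra_simps)
  qed (use A y0 in simp)
  finally have "16 * (t * t) \<le> 4 * (A * y)" by simp
  also have "\<dots> \<le> (A + y)\<^sup>2"
    using zero_le_power2[of "A - y"] by (simp add: power2_eq_square algebra_simps)
  finally have "(4 * t)\<^sup>2 \<le> (A + y)\<^sup>2" by (simp add: power2_eq_square)
  then have "4 * t \<le> A + y" by (rule power2_le_imp_le) (use A y0 in auto)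
  then show False using neg t3 unfolding t_def O by argo
qed

lemma prod_list_between_0_1:
  fixes f :: "'b \<Rightarrow> real"
  assumes "\<And>i. i \<in> set xs \<Longrightarrow> 0 \<le> f i \<and> f i \<le> 1"
  shows "0 \<le> (\<Prod>i\<leftarrow>xs. f i)" "(\<Prod>i\<leftarrow>xs. f i) \<le> 1"
  using assms by (induction xs) (auto intro: mult_le_one)

text \<open>Both sides share the payoff \<open>G\<close> from \<open>H\<close> and weight the
  remainder by \<open>q\<close>, so \<open>loss_bound\<close> applies to the remainder alone;
  \<open>G\<close> is nonnegative and survives the factor 5/4. \<open>Z\<close> holds the variables
  left over by \<open>H\<close>, \<open>m\<close> and \<open>L\<close>, observed first and
  declined.\<close>

lemma accept_value_le_reward_either:
  fixes a b p :: "nat \<Rightarrow> real"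
  assumes p: "\<And>i. i \<in> insert m (set Z \<union> set H \<union> set L) \<Longrightarrow> 0 \<le> p i \<and> p i \<le> 1"
    and m: "0 \<le> a m" "a m \<le> b m"
    and H: "\<And>i. i \<in> set H \<Longrightarrow> b m \<le> b i"
    and L: "\<And>i. i \<in> set L \<Longrightarrow> a m \<le> b i \<and> b i \<le> b m"
    and R1: "reward a b p (Z @ H @ L @ [m]) 0 \<le> R"
    and R2: "reward a b p (Z @ H @ m # L) 0 \<le> R"
  shows "accept_value b p (H @ m # L) (a m) \<le> 5 / 4 * R"
proof -
  define q where "q = (\<Prod>i\<leftarrow>H. 1 - p i)"
  define l where "l = (\<Prod>i\<leftarrow>L. 1 - p i)"
  define G where "G = accept_value b p H 0"
  define W where "W = accept_value b p L 0"
  have H_eq: "accept_value b p H v = G + q * v" for v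
    unfolding G_def q_def by (rule accept_value_affine)
  have L_eq: "accept_value b p L v = W + l * v" for v
    unfolding W_def l_def by (rule accept_value_affine)
  have q: "0 \<le> q" and l: "0 \<le> l" "l \<le> 1"
    unfolding q_def l_def using p by (auto intro!: prod_list_between_0_1)
  have G: "0 \<le> G" unfolding G_def
    using p H m by (intro accept_value_ge) force+
  have pm: "0 \<le> p m" "p m \<le> 1" using p by auto
  have W_le: "W + l * b m \<le> b m"
    unfolding L_eq[symmetric] using p L by (intro accept_value_le) auto
  have W_ge: "a m \<le> W + l * a m"
    unfolding L_eq[symmetric] using p L by (intro accept_value_ge) auto
  define v where "v = p m * b m + (1 - p m) * a m"
  have last: "v = reward a b p [m] 0" using m by (simp add: v_def)
  have R_ge: "G + q * w \<le> R"
    if "w \<le> reward a b p ys 0" "reward a b p (Z @ H @ ys) 0 \<le> R" for w ys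
  proof -
    have "G + q * w \<le> reward a b p H w"
      unfolding H_eq[symmetric] using p by (intro accept_value_le_reward) auto
    also have "\<dots> \<le> reward a b p H (reward a b p ys 0)"
      using p that by (intro reward_mono) auto
    also have "\<dots> \<le> reward a b p Z \<dots>" using p by (intro le_reward) auto
    finally show ?thesis using that by simp
  qed
  have acc: "G + q * (W + l * v) \<le> R"
  proof (rule R_ge[OF _ R1])
    show "W + l * v \<le> reward a b p (L @ [m]) 0"
      using accept_value_le_reward[of L p b v a] p
      by (simp add: L_eq last del: reward_simps(1,2))
  qed
  have skip: "G + q * v \<le> R"
  proof (rule R_ge[OF _ R1])
    show "v \<le> reward a b p (L @ [m]) 0"
      using le_reward[of L p v a b] p by (simp add: last del: reward_simps(1,2))
  qed
  have early: "G + q * (p m * b m + (1 - p m) * W) \<le> R"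
  proof (rule R_ge[OF _ R2])
    have "W \<le> reward a b p L 0"
      unfolding W_def using p by (intro accept_value_le_reward) auto
    then show "p m * b m + (1 - p m) * W \<le> reward a b p (m # L) 0"
      using pm by (auto intro!: add_mono mult_left_mono simp: le_max_iff_disj)
  qed
  \<comment> \<open>The best of the three imitations after \<open>H\<close>, used as the
    \<open>R\<close> of \<open>loss_bound\<close>.\<close>
  define u where "u = max (W + l * v) (max (p m * b m + (1 - p m) * W) v)"
  have "G + q * u \<le> R" using acc skip early by (simp add: u_def max_def)
  moreover have "p m * b m + (1 - p m) * (W + l * a m) \<le> 5 / 4 * u"
    using m pm l W_ge W_le
    by (intro loss_bound) (auto simp: u_def v_def algebra_simps le_max_iff_disj)
  then have "q * (p m * b m + (1 - p m) * (W + l * a m)) \<le> q * (5 / 4 * u)"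
    using q by (rule mult_left_mono)
  moreover have "accept_value b p (H @ m # L) (a m) =
      G + q * (p m * b m + (1 - p m) * (W + l * a m))"
    by (simp only: accept_value_simps H_eq L_eq)
  moreover have "q * (5 / 4 * u) = 5 / 4 * (q * u)" by simp
  ultimately show ?thesis using G by linarith
qed

section \<open>Two-point variables and random acceptance indicators\<close>

lemma (in prob_space) two_point_distributed_integral:
  assumes X: "two_point_distributed M X a b p" and f: "f \<in> borel_measurable borel"
  shows "expectation (\<lambda>\<omega>. f (X \<omega>)) = p * f b + (1 - p) * f a"
proof -
  have [measurable]: "X \<in> borel_measurable M" and p: "0 \<le> p" "p \<le> 1"
    and D: "distr M borel X =
      distr (measure_pmf (bernoulli_pmf p)) borel (\<lambda>c. if c then b else a)"
    using X unfolding two_point_distributed_def by blast+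
  have "expectation (\<lambda>\<omega>. f (X \<omega>)) = integral\<^sup>L (distr M borel X) f"
    using f by (simp add: integral_distr)
  also have "\<dots> = measure_pmf.expectation (bernoulli_pmf p) (\<lambda>c. f (if c then b else a))"
    unfolding D using f by (simp add: integral_distr)
  also have "\<dots> = p * f b + (1 - p) * f a" using p by simp
  finally show ?thesis .
qed

lemma (in prob_space) two_point_distributed_AE:
  assumes X: "two_point_distributed M X a b p"
  shows "AE \<omega> in M. X \<omega> = a \<or> X \<omega> = b"
proof -
  have meas: "X \<in> borel_measurable M"
    and D: "distr M borel X =
      distr (measure_pmf (bernoulli_pmf p)) borel (\<lambda>c. if c then b else a)"
    using X unfolding two_point_distributed_def by blast+
  have "{x. x = a \<or> x = b} = {a, b}" by blast
  then have S: "{x \<in> space borel. x = a \<or> x = b} \<in> sets borel" by simp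
  have g: "(\<lambda>c. if c then b else a) \<in> borel_measurable (measure_pmf (bernoulli_pmf p))"
    by simp
  have "AE x in distr M borel X. x = a \<or> x = b"
    unfolding D AE_distr_iff[OF g S] by (rule AE_I2) simp
  then show ?thesis by (rule AE_distrD[OF meas])
qed

text \<open>\<open>accept_value\<close> is affine in each weight separately, so for independent
  weights the expectation may be taken inside. The extra product over \<open>S\<close> strengthens
  the induction: only expectations of products over distinct indices are then needed.\<close>

lemma (in prob_space) expectation_accept_value:
  assumes indep: "indep_vars (\<lambda>_. borel) \<phi> I"
    and int: "\<And>i. i \<in> I \<Longrightarrow> integrable M (\<phi> i)"
    and q: "\<And>i. i \<in> I \<Longrightarrow> expectation (\<phi> i) = q i"
    and "distinct xs" "set xs \<subseteq> I" "finite S" "S \<subseteq> I" "S \<inter> set xs = {}"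
  shows "integrable M (\<lambda>\<omega>. (\<Prod>j\<in>S. 1 - \<phi> j \<omega>) * accept_value b (\<lambda>i. \<phi> i \<omega>) xs v) \<and>
    expectation (\<lambda>\<omega>. (\<Prod>j\<in>S. 1 - \<phi> j \<omega>) * accept_value b (\<lambda>i. \<phi> i \<omega>) xs v) =
      (\<Prod>j\<in>S. 1 - q j) * accept_value b q xs v"
  using assms(4-)
proof (induction xs arbitrary: S)
  have prod: "integrable M (\<lambda>\<omega>. \<Prod>j\<in>S. 1 - \<phi> j \<omega>) \<and>
      expectation (\<lambda>\<omega>. \<Prod>j\<in>S. 1 - \<phi> j \<omega>) = (\<Prod>j\<in>S. 1 - q j)"
    if S: "finite S" "S \<subseteq> I" for S
  proof -
    have ind: "indep_vars (\<lambda>_. borel) (\<lambda>i \<omega>. 1 - \<phi> i \<omega>) S"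
      using indep_vars_compose2[OF indep_vars_subset[OF indep S(2)], of "\<lambda>_ x. 1 - x" "\<lambda>_. borel"]
      by simp
    have i1: "integrable M (\<lambda>\<omega>. 1 - \<phi> i \<omega>)" if "i \<in> S" for i
      using that S int by auto
    have "expectation (\<lambda>\<omega>. 1 - \<phi> i \<omega>) = 1 - q i" if "i \<in> S" for i
      using that S int q by (subst Bochner_Integration.integral_diff) (auto simp: prob_space)
    then show ?thesis
      using indep_vars_integrable[OF S(1) ind i1] indep_vars_lebesgue_integral[OF S(1) ind i1]
      by (simp cong: prod.cong)
  qed
  {
    case Nil
    then show ?case using prod[of S] by simp
  next
    case (Cons i xs)
    let ?P = "\<lambda>\<omega>. \<Prod>j\<in>S. 1 - \<phi> j \<omega>" and ?P' = "\<lambda>\<omega>. \<Prod>j\<in>insert i S. 1 - \<phi> j \<omega>"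
    let ?F = "\<lambda>\<omega>. accept_value b (\<lambda>i. \<phi> i \<omega>) xs v"
    have i: "i \<notin> S" "insert i S \<subseteq> I" "finite (insert i S)" using Cons.prems by auto
    \<comment> \<open>Writing \<open>\<phi> i\<close> as \<open>1 - (1 - \<phi> i)\<close> leaves
      only products of complements, with \<open>i\<close> moved into \<open>S\<close>.\<close>
    have eq: "?P \<omega> * accept_value b (\<lambda>i. \<phi> i \<omega>) (i # xs) v =
        b i * ?P \<omega> - b i * ?P' \<omega> + ?P' \<omega> * ?F \<omega>" for \<omega>
      using i(1,3) by (simp add: algebra_simps)
    have IH: "integrable M (\<lambda>\<omega>. ?P' \<omega> * ?F \<omega>) \<and>
        expectation (\<lambda>\<omega>. ?P' \<omega> * ?F \<omega>) = (\<Prod>j\<in>insert i S. 1 - q j) * accept_value b q xs v"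
      using Cons.prems by (intro Cons.IH) auto
    note P = prod[of S, OF Cons.prems(3,4)] and P' = prod[OF i(3,2)]
    have "expectation (\<lambda>\<omega>. b i * ?P \<omega> - b i * ?P' \<omega> + ?P' \<omega> * ?F \<omega>) =
        b i * (\<Prod>j\<in>S. 1 - q j) - b i * (\<Prod>j\<in>insert i S. 1 - q j)
          + (\<Prod>j\<in>insert i S. 1 - q j) * accept_value b q xs v"
      using P P' IH by (simp del: prod.insert)
    also have "\<dots> = (\<Prod>j\<in>S. 1 - q j) * accept_value b q (i # xs) v"
      using i(1,3) by (simp add: algebra_simps)
    finally have E: "expectation (\<lambda>\<omega>. b i * ?P \<omega> - b i * ?P' \<omega> + ?P' \<omega> * ?F \<omega>) =
        (\<Prod>j\<in>S. 1 - q j) * accept_value b q (i # xs) v" .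
    show ?case
      unfolding eq using P P' IH E by (auto simp del: prod.insert accept_value_simps)
  }
qed

text \<open>With 0/1 weights the recursion returns \<open>b\<close> at the first hit, and decreasing
  order makes this at least \<open>b\<close> at any other hit.\<close>

lemma le_accept_value_of_hit:
  assumes "\<And>i. i \<in> set xs \<Longrightarrow> p i = 0 \<or> p i = 1"
    and "sorted_wrt (\<lambda>i j. b j \<le> b i) xs" and "k \<in> set xs" "p k = 1"
  shows "b k \<le> accept_value b p xs v"
  using assms
proof (induction xs)
  case (Cons i xs)
  have "p i = 0 \<or> p i = 1" using Cons.prems(1)[of i] by simp
  then show ?case by (elim disjE) (use Cons in auto)
qed simp

section \<open>Backward induction and orders of observation\<close>

lemma stopping_value_eq_reward:
  assumes step: "\<And>i v. i \<in> {1..n} \<Longrightarrow> 0 \<le> v \<Longrightarrow>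
      integral\<^sup>L M (\<lambda>\<omega>. max (X i \<omega>) v) = p i * max (b i) v + (1 - p i) * max (a i) v"
    and p: "\<And>i. i \<in> {1..n} \<Longrightarrow> 0 \<le> p i \<and> p i \<le> 1"
    and \<sigma>: "\<And>j. j \<in> {1..n} \<Longrightarrow> \<sigma> j \<in> {1..n}"
  shows "stopping_value M n X \<sigma> = reward a b p (map \<sigma> [1..<Suc n]) 0"
proof -
  have "stopping_value_from M n X \<sigma> j = reward a b p (map \<sigma> [j..<Suc n]) 0"
    if "j \<le> Suc n" "1 \<le> j" for j
    using that
  proof (induction rule: inc_induct)
    case base
    then show ?case by (simp add: stopping_value_from.simps)
  next
    case (step k)
    \<comment> \<open>The one-step formula is assumed only for nonnegative continuation values,
      since it will be used with truncated \<open>a\<close> and \<open>b\<close>.\<close>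
    have "0 \<le> reward a b p (map \<sigma> [Suc k..<Suc n]) 0"
      using p \<sigma> step.hyps step.prems by (intro le_reward) auto
    moreover have "\<sigma> k \<in> {1..n}" using \<sigma> step.hyps step.prems by auto
    ultimately show ?case
      using step assms(1)
      by (subst stopping_value_from.simps)
         (simp add: upt_conv_Cons[of k "Suc n"] del: upt_Suc)
  qed
  then show ?thesis by (simp add: stopping_value_def del: upt_Suc)
qed

lemma distinct_list_permutes:
  assumes "distinct xs" "set xs = {1..n}"
  obtains \<sigma> where "\<sigma> permutes {1..n}" "map \<sigma> [1..<Suc n] = xs"
proof
  \<comment> \<open>Observations are numbered from 1, list entries from 0; \<open>permutes\<close>
    demands the identity elsewhere.\<close>
  define \<sigma> where "\<sigma> j = (if j \<in> {1..n} then xs ! (j - 1) else j)" for j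
  have len: "length xs = n" using distinct_card[OF assms(1)] assms(2) by simp
  show "map \<sigma> [1..<Suc n] = xs"
    using len by (auto intro!: nth_equalityI simp: \<sigma>_def simp del: upt_Suc)
  then have "\<sigma> ` {1..n} = {1..n}"
    using assms(2) by (metis set_map set_upt atLeastLessThanSuc_atLeastAtMost)
  then have "bij_betw \<sigma> {1..n} {1..n}"
    by (simp add: bij_betw_def finite_surj_inj)
  then show "\<sigma> permutes {1..n}"
    by (rule bij_imp_permutes) (auto simp: \<sigma>_def)
qed

section \<open>Application to the random variables\<close>

theorem theorem3:
  fixes M :: "'a measure" and n :: nat and X :: "nat \<Rightarrow> 'a \<Rightarrow> real"
    and a b p :: "nat \<Rightarrow> real"
  assumes "prob_space M"
    and "n \<ge> 1"
    and "prob_space.indep_vars M (\<lambda>_. borel) X {1..n}"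
    and "\<And>i. i \<in> {1..n} \<Longrightarrow> two_point_distributed M (X i) (a i) (b i) (p i)"
  shows "integral\<^sup>L M (\<lambda>\<omega>. MAX i\<in>{1..n}. X i \<omega>)
           / (MAX \<sigma>\<in>{\<sigma>. \<sigma> permutes {1..n}}. stopping_value M n X \<sigma>) \<le> 1.25"
proof -
  interpret prob_space M by fact
  note indep = assms(3) and tp = assms(4)
  define I where "I = {1..n}"
  define a' where "a' i = max (a i) 0" for i
  define b' where "b' i = max (b i) 0" for i
  \<comment> \<open>For \<open>a i = b i\<close> the weight \<open>p i\<close> is not determined by the law of \<open>X i\<close>; \<open>0\<close> is the value
    matching the indicator \<open>\<phi> i\<close>, whose junk denominator makes it vanish.\<close>
  define q where "q i = (if a i < b i then p i else 0)" for i
  \<comment> \<open>Almost surely the indicator of a high value when \<open>a i < b i\<close>; as an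
    affine image of \<open>X i\<close> it inherits independence and integrability.\<close>
  define \<phi> where "\<phi> i \<omega> = (X i \<omega> - a i) / (b i - a i)" for i \<omega>
  have ab: "a i \<le> b i" and q: "0 \<le> q i \<and> q i \<le> 1" if "i \<in> I" for i
    using tp[of i] that by (auto simp: two_point_distributed_def q_def I_def)
  have expect: "expectation (\<lambda>\<omega>. f (X i \<omega>)) = q i * f (b i) + (1 - q i) * f (a i)"
    if "i \<in> I" "f \<in> borel_measurable borel" for i and f :: "real \<Rightarrow> real"
    using two_point_distributed_integral[OF tp[of i] that(2)] that(1) ab[of i]
    by (cases "a i = b i") (auto simp: q_def I_def algebra_simps)
  have step: "expectation (\<lambda>\<omega>. max (X i \<omega>) v) = q i * max (b' i) v + (1 - q i) * max (a' i) v"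
    if "i \<in> {1..n}" "0 \<le> v" for i v
    using expect[of i "\<lambda>x. max x v"] that by (simp add: I_def a'_def b'_def max.assoc max_absorb2)
  have AE_X: "AE \<omega> in M. \<forall>i\<in>I. X i \<omega> = a i \<or> X i \<omega> = b i"
    by (intro AE_finite_allI two_point_distributed_AE[OF tp]) (auto simp: I_def)
  have int_X: "integrable M (X i)" if "i \<in> I" for i
  proof (rule integrable_const_bound[of _ "max \<bar>a i\<bar> \<bar>b i\<bar>"])
    show "AE \<omega> in M. norm (X i \<omega>) \<le> max \<bar>a i\<bar> \<bar>b i\<bar>" 
      using AE_X by (rule eventually_mono) (use that in auto)
    show "X i \<in> borel_measurable M" using tp[of i] that by (simp add: two_point_distributed_def I_def)
  qed
  have int_\<phi>: "integrable M (\<phi> i)" if "i \<in> I" for i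
    unfolding \<phi>_def using int_X[OF that] by simp
  have E_\<phi>: "expectation (\<phi> i) = q i" if "i \<in> I" for i
    using expect[of i "\<lambda>x. (x - a i) / (b i - a i)"] that ab[OF that]
    by (auto simp: \<phi>_def[abs_def] q_def)
  have indep_\<phi>: "indep_vars (\<lambda>_. borel) \<phi> I"
    using indep_vars_compose2[OF indep, of "\<lambda>i x. (x - a i) / (b i - a i)" "\<lambda>_. borel"]
    by (simp add: \<phi>_def[abs_def] I_def)

  have I: "finite I" "I \<noteq> {}" using \<open>n \<ge> 1\<close> by (auto simp: I_def)
  obtain m where m: "m \<in> I" "\<And>i. i \<in> I \<Longrightarrow> a' i \<le> a' m"
    using Max_in[of "a' ` I"] Max_ge[of "a' ` I"] I
    by (metis (no_types, lifting) finite_imageI image_iff image_is_empty imageI)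
  define xs where "xs = sort_key (\<lambda>i. - b' i) (filter (\<lambda>i. i \<noteq> m) [1..<Suc n])"
  define H where "H = filter (\<lambda>i. b' m < b' i) xs"
  define L where "L = filter (\<lambda>i. b' i \<le> b' m \<and> a' m \<le> b' i) xs"
  \<comment> \<open>These variables never exceed the consolation prize \<open>a' m\<close>, but an
    order must still contain them.\<close>
  define Z where "Z = filter (\<lambda>i. b' i < a' m) xs"
  have ab': "0 \<le> a' i" "a' i \<le> b' i" if "i \<in> I" for i
    using ab[OF that] by (auto simp: a'_def b'_def)
  have set_xs: "set xs = I - {m}" and dist_xs: "distinct xs"
    unfolding xs_def I_def by (auto simp del: upt_Suc)
  have sort_xs: "sorted_wrt (\<lambda>i j. b' j \<le> b' i) xs"
    using sorted_sort_key[of "\<lambda>i. - b' i"] unfolding xs_def by (simp add: sorted_map)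
  have sets: "set H \<subseteq> I" "set L \<subseteq> I" "set Z \<subseteq> I" "m \<notin> set H" "m \<notin> set L" "m \<notin> set Z"
    using set_xs by (auto simp: H_def L_def Z_def)
  have sortHL: "sorted_wrt (\<lambda>i j. b' j \<le> b' i) (H @ m # L)"
    using sort_xs by (auto simp: H_def L_def sorted_wrt_append sorted_wrt_filter)
  have cover: "insert m (set Z \<union> set H \<union> set L) = I"
  proof -
    have "set Z \<union> set H \<union> set L = set xs"
      unfolding H_def L_def Z_def set_filter by force
    then show ?thesis using set_xs m(1) by blast
  qed
  have mb: "a' m \<le> b' m" using ab'(2)[OF m(1)] .
  have disj: "set Z \<inter> set H = {}" "set Z \<inter> set L = {}" "set H \<inter> set L = {}"
    using mb by (auto simp: H_def L_def Z_def)
  have dist: "distinct H" "distinct L" "distinct Z"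
    using dist_xs by (auto simp: H_def L_def Z_def)

  let ?V = "MAX \<sigma>\<in>{\<sigma>. \<sigma> permutes {1..n}}. stopping_value M n X \<sigma>"
  have V: "reward a' b' q ys 0 \<le> ?V" if ys: "distinct ys" "set ys = I" for ys
  proof -
    obtain \<sigma> where \<sigma>: "\<sigma> permutes {1..n}" "map \<sigma> [1..<Suc n] = ys"
      using distinct_list_permutes[OF ys(1) ys(2)[unfolded I_def]] by blast
    have "stopping_value M n X \<sigma> = reward a' b' q ys 0"
      unfolding \<sigma>(2)[symmetric]
    proof (rule stopping_value_eq_reward[OF step])
      show "0 \<le> q i \<and> q i \<le> 1" if "i \<in> {1..n}" for i
        using q that unfolding I_def by blast
      show "\<sigma> j \<in> {1..n}" if "j \<in> {1..n}" for j
        using permutes_in_image[OF \<sigma>(1)] that by blast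
    qed
    then show ?thesis
      using \<sigma>(1) finite_permutations[of "{1..n}"]
      by (intro Max_ge) (auto intro!: rev_image_eqI)
  qed
  have V1: "reward a' b' q (Z @ H @ L @ [m]) 0 \<le> ?V"
    by (rule V) (use dist disj sets in simp, unfold cover[symmetric], auto)
  have V2: "reward a' b' q (Z @ H @ m # L) 0 \<le> ?V"
    by (rule V) (use dist disj sets in simp, unfold cover[symmetric], auto)

  \<comment> \<open>The pathwise payoff of taking the first high value, with consolation prize
    \<open>a' m\<close>; it dominates the maximum almost surely.\<close>
  let ?F = "\<lambda>\<omega>. accept_value b' (\<lambda>i. \<phi> i \<omega>) (H @ m # L) (a' m)"
  have F: "integrable M ?F" "expectation ?F = accept_value b' q (H @ m # L) (a' m)"
    using expectation_accept_value[OF indep_\<phi> int_\<phi> E_\<phi>, of "H @ m # L" "{}" b' "a' m"]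
      dist disj sets m(1) by auto
  have pointwise: "AE \<omega> in M. (MAX i\<in>{1..n}. X i \<omega>) \<le> ?F \<omega> \<and> 0 \<le> ?F \<omega>"
    using AE_X
  proof eventually_elim
    case (elim \<omega>)
    have \<phi>01: "\<phi> i \<omega> = 0 \<and> X i \<omega> \<le> a' i \<or> \<phi> i \<omega> = 1 \<and> X i \<omega> \<le> b' i" if "i \<in> I" for i
      using elim that ab[OF that] by (cases "a i = b i") (auto simp: \<phi>_def a'_def b'_def)
    have HL: "i \<in> I" "a' m \<le> b' i" if "i \<in> set (H @ m # L)" for i
      using that sets m(1) mb by (auto simp: H_def L_def)
    have F_ge: "a' m \<le> ?F \<omega>"
    proof (rule accept_value_ge)
      show "0 \<le> \<phi> i \<omega> \<and> \<phi> i \<omega> \<le> 1 \<and> a' m \<le> b' i" if "i \<in> set (H @ m # L)" for i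
        using \<phi>01[OF HL(1)[OF that]] HL(2)[OF that] by auto
    qed simp
    have "X k \<omega> \<le> ?F \<omega>" if k: "k \<in> I" for k
    proof (cases "\<phi> k \<omega> = 0 \<or> k \<in> set Z")
      case True
      then have "X k \<omega> \<le> a' m"
        using \<phi>01[OF k] m(2)[OF k] by (auto simp: Z_def)
      then show ?thesis using F_ge by simp
    next
      case False
      then have kk: "k \<in> set (H @ m # L)" "\<phi> k \<omega> = 1" "X k \<omega> \<le> b' k"
        using k[folded cover] \<phi>01[OF k] by auto
      have "b' k \<le> ?F \<omega>"
      proof (rule le_accept_value_of_hit[where p = "\<lambda>i. \<phi> i \<omega>", OF _ sortHL kk(1,2)])
        show "\<phi> i \<omega> = 0 \<or> \<phi> i \<omega> = 1" if "i \<in> set (H @ m # L)" for i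
          using \<phi>01[OF HL(1)[OF that]] by blast
      qed
      with kk(3) show ?thesis by (rule order_trans)
    qed
    then show ?case
      using I F_ge ab'[OF m(1)] unfolding I_def[symmetric] by (simp del: accept_value_simps)
  qed
  \<comment> \<open>The bound \<open>0 \<le> ?F \<omega>\<close> in \<open>pointwise\<close>
    replaces a proof that the maximum is integrable: a non-integrable function has integral 0 by
    default.\<close>
  have "expectation (\<lambda>\<omega>. MAX i\<in>{1..n}. X i \<omega>) \<le> expectation ?F"
    by (intro integral_mono_AE' F eventually_mono[OF pointwise]) auto
  also have "\<dots> \<le> 5 / 4 * ?V"
    unfolding F(2)
  proof (rule accept_value_le_reward_either[OF _ _ _ _ _ V1 V2])
    show "0 \<le> q i \<and> q i \<le> 1" if "i \<in> insert m (set Z \<union> set H \<union> set L)" for i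
      using q that unfolding cover by simp
  qed (use ab'(1)[OF m(1)] mb in \<open>auto simp: H_def L_def\<close>)
  finally have le: "expectation (\<lambda>\<omega>. MAX i\<in>{1..n}. X i \<omega>) \<le> 5 / 4 * ?V" .
  have "0 \<le> reward a' b' q (Z @ H @ m # L) 0"
  proof (rule le_reward)
    show "0 \<le> q i \<and> q i \<le> 1" if "i \<in> set (Z @ H @ m # L)" for i
      by (rule q, fold cover) (use that in auto)
  qed
  then have "0 \<le> ?V" using V2 by linarith
  \<comment> \<open>If the best stopping value is 0, the quotient is 0 by the convention for
    division.\<close>
  then show ?thesis
    using le by (cases "?V = 0") (auto simp: divide_le_eq)
qed

end
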